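(* Let $G$ and $H$ be finitely generated free groups, with $G$ having free generators $a_1,\dots,a_n$ and with the rank of $H$ greater than $1$. Let $\phi,\psi: G\to H$ be homomorphisms and let $u,v\in H$. Let $\bar\phi=\phi*u*v : G*\mathbb Z*\mathbb Z\to H$ be the homomorphism which equals $\phi$ on $G$ and sends the generator $b_1$ of the first $\mathbb Z$ factor to $u$ and the generator $b_2$ of the second $\mathbb Z$ factor to $v$. If $\bar\phi$ has remnant, and \[ |\operatorname{Rem}_{\bar\phi} a_i|\ \ge\ |\psi(a_i)| \] for all generators $a_i$ of $G$, then $[u]\neq[v]$, i.e. there is no $z\in G$ with $u=\phi(z)\,v\,\psi(z)^{-1}$.
   Context: Free groups come with fixed free generating sets; $|w|$ denotes the reduced word length of $w$. For homomorphisms $\phi,\psi:G\to H$, elements $u,v\in H$ are in the same doubly-twisted conjugacy class, written $[u]=[v]$, if and only if there is $z\in G$ with $u=\phi(z)v\psi(z)^{-1}$. Remnant. Let $t=(h_1,\dots,h_m)$ be a tuple of reduced words in a free group. We say $t$ has remnant when, for each $i$, there is a nontrivial subword of $h_i$ which does not cancel in any product of the form $h_j^{\alpha_j}h_ih_k^{\beta_k}$, where $j,k\in\{1,\dots,m\}$, with $\alpha_l,\beta_l\in\{-1,0,1\}$ for $l\ne i$ and $\alpha_i,\beta_i\in\{0,1\}$. The (maximal) such noncancelling subword is the remnant of $h_i$. Explicitly: delete from $h_i$ the longest initial segment that cancels in some product $h_j^{\alpha_j}h_i$ and the longest terminal segment that cancels in some product $h_ih_k^{\beta_k}$ (with $j,k\in\{1,\dots,m\}$,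 $\alpha_j\in\{-1,0,1\}$ if $j\ne i$ and $\alpha_j\in\{0,1\}$ if $j=i$, $\beta_k\in\{-1,0,1\}$ if $k\ne i$ and $\beta_k\in\{0,1\}$ if $k=i$); $t$ has remnant if for each $i$ these segments have total length less than $|h_i|$, and what is left is the remnant of $h_i$. If a free group $K$ has generators $c_1,\dots,c_m$ and $\rho:K\to H$ is a homomorphism, then $\rho$ has remnant if the tuple $(\rho(c_1),\dots,\rho(c_m))$ has remnant, and $\operatorname{Rem}_\rho c_i$ denotes the remnant of $\rho(c_i)$. Here $G*\mathbb Z*\mathbb Z$ has generators $a_1,\dots,a_n,b_1,b_2$, so the tuple for $\bar\phi$ is $(\phi(a_1),\dots,\phi(a_n),u,v)$. *)

theory Defs
  imports "HOL-Algebra.Group" "HOL-Library.Sublist"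
begin

text \<open>The letter \<open>(x, True)\<close> stands for the generator \<open>x\<close> and \<open>(x, False)\<close> for its inverse.\<close>

type_synonym 'a word = "('a \<times> bool) list"

definition inv_letter :: "'a \<times> bool \<Rightarrow> 'a \<times> bool" where
  "inv_letter l = (fst l, \<not> snd l)"

definition inv_word :: "'a word \<Rightarrow> 'a word" where
  "inv_word w = rev (map inv_letter w)"

definition reduced :: "'a word \<Rightarrow> bool" where
  "reduced w \<longleftrightarrow> successively (\<lambda>k l. l \<noteq> inv_letter k) w"

fun push :: "'a \<times> bool \<Rightarrow> 'a word \<Rightarrow> 'a word" where
  "push l [] = [l]"
| "push l (k # w) = (if k = inv_letter l then w else l # k # w)"

definition reduce :: "'a word \<Rightarrow> 'a word" where
  "reduce w = foldr push w []"

text \<open>The free group with free generating set \<open>S\<close>, realised on the reduced words over \<open>S\<close>. The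
  reduced word length of an element is therefore its \<open>length\<close> as a list.\<close>

definition free_group :: "'a set \<Rightarrow> 'a word monoid" where
  "free_group S =
     \<lparr>carrier = {w. reduced w \<and> fst ` set w \<subseteq> S}, mult = (\<lambda>v w. reduce (v @ w)), one = []\<rparr>"

definition gen :: "'a \<Rightarrow> 'a word" where
  "gen x = [(x, True)]"

lemma inv_letter_inv_letter [simp]: "inv_letter (inv_letter l) = l"
  by (simp add: inv_letter_def)

lemma fst_inv_letter [simp]: "fst (inv_letter l) = fst l"
  by (simp add: inv_letter_def)

lemma reduced_push: "reduced w \<Longrightarrow> reduced (push l w)"
  by (cases w) (auto simp: reduced_def successively_Cons)

lemma reduced_foldr_push: "reduced w \<Longrightarrow> reduced (foldr push v w)"
  by (induction v) (auto intro: reduced_push)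

lemma push_push_inv_letter: "reduced w \<Longrightarrow> push l (push (inv_letter l) w) = w"
  by (cases w rule: remdups_adj.cases) (auto simp: reduced_def)

lemma foldr_push_push:
  assumes "reduced w"
  shows "foldr push (push l v) w = push l (foldr push v w)"
  by (cases v) (auto simp: push_push_inv_letter reduced_foldr_push assms)

lemma foldr_push_reduce: "reduced w \<Longrightarrow> foldr push (reduce v) w = foldr push v w"
  by (induction v) (simp_all add: reduce_def foldr_push_push)

lemma reduce_reduced: "reduced w \<Longrightarrow> reduce w = w"
proof (induction w)
  case (Cons l w)
  then show ?case by (cases w) (auto simp: reduce_def reduced_def)
qed (simp add: reduce_def)

lemma reduced_reduce [simp]: "reduced (reduce w)"
  unfolding reduce_def by (rule reduced_foldr_push) (simp add: reduced_def)

lemma reduce_append: "reduce (v @ w) = foldr push v (reduce w)"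
  by (simp add: reduce_def)

lemma set_push: "set (push l w) \<subseteq> insert l (set w)"
  by (cases w) auto

lemma set_reduce: "set (reduce w) \<subseteq> set w"
proof (induction w)
  case (Cons l w)
  then show ?case using set_push[of l "reduce w"] by (auto simp: reduce_def)
qed (simp add: reduce_def)

lemma reduced_inv_word: "reduced w \<Longrightarrow> reduced (inv_word w)"
  unfolding reduced_def inv_word_def successively_rev successively_map
  by (erule successively_mono) (metis inv_letter_inv_letter)

lemma reduce_inv_word_append: "reduce (inv_word w @ w) = []"
proof -
  have "reduce (inv_word w @ w @ v) = reduce v" for v
  proof (induction w arbitrary: v)
    case (Cons l w)
    have "reduce (inv_word (l # w) @ (l # w) @ v)
        = foldr push (inv_word w) (push (inv_letter l) (push (inv_letter (inv_letter l)) (reduce (w @ v))))"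
      by (simp add: inv_word_def reduce_append) (simp add: reduce_def)
    also have "\<dots> = reduce (inv_word w @ w @ v)"
      by (subst push_push_inv_letter) (simp_all add: reduce_append reduced_foldr_push)
    finally show ?case using Cons by simp
  qed (simp add: inv_word_def)
  from this[of "[]"] show ?thesis by (simp add: reduce_def)
qed

lemma inv_word_closed:
  "w \<in> carrier (free_group S) \<Longrightarrow> inv_word w \<in> carrier (free_group S)"
  by (fastforce simp: free_group_def reduced_inv_word inv_word_def[of w] image_image
      intro: reduced_inv_word[unfolded inv_word_def])

theorem group_free_group: "group (free_group S)"
proof (rule groupI)
  fix u v w assume "u \<in> carrier (free_group S)" "v \<in> carrier (free_group S)"
    "w \<in> carrier (free_group S)"
  then have "reduced w" "reduced (reduce (v @ w))" by (simp_all add: free_group_def)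
  then have "reduce (reduce (u @ v) @ w) = foldr push u (reduce (v @ w))"
    by (simp add: reduce_append[of "reduce _"] foldr_push_reduce reduce_reduced)
      (simp add: reduce_append reduce_reduced)
  also have "\<dots> = reduce (u @ reduce (v @ w))"
    by (simp add: reduce_append[of u] reduce_reduced)
  finally show "u \<otimes>\<^bsub>free_group S\<^esub> v \<otimes>\<^bsub>free_group S\<^esub> w
      = u \<otimes>\<^bsub>free_group S\<^esub> (v \<otimes>\<^bsub>free_group S\<^esub> w)"
    by (simp add: free_group_def)
next
  fix v w assume "v \<in> carrier (free_group S)" "w \<in> carrier (free_group S)"
  then show "v \<otimes>\<^bsub>free_group S\<^esub> w \<in> carrier (free_group S)"
    using set_reduce[of "v @ w"] by (fastforce simp: free_group_def)
next
  fix w assume w: "w \<in> carrier (free_group S)"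
  show "\<exists>v\<in>carrier (free_group S). v \<otimes>\<^bsub>free_group S\<^esub> w = \<one>\<^bsub>free_group S\<^esub>"
    using inv_word_closed[OF w] by (auto simp: free_group_def reduce_inv_word_append)
qed (auto simp: free_group_def reduce_reduced reduced_def)

lemma inv_free_group:
  assumes "w \<in> carrier (free_group S)"
  shows "inv\<^bsub>free_group S\<^esub> w = inv_word w"
  using group.inv_equality[OF group_free_group _ assms inv_word_closed[OF assms]]
  by (simp add: free_group_def reduce_inv_word_append)

definition doubly_twisted_conj ::
  "('a, 'm) monoid_scheme \<Rightarrow> ('b, 'k) monoid_scheme \<Rightarrow> ('a \<Rightarrow> 'b) \<Rightarrow> ('a \<Rightarrow> 'b) \<Rightarrow> 'b \<Rightarrow> 'b \<Rightarrow> bool"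
  where "doubly_twisted_conj G H \<phi> \<psi> u v \<longleftrightarrow>
    (\<exists>z\<in>carrier G. u = \<phi> z \<otimes>\<^bsub>H\<^esub> v \<otimes>\<^bsub>H\<^esub> inv\<^bsub>H\<^esub> (\<psi> z))"

text \<open>Powers do not depend on the generating set over which the word is read, so \<open>UNIV\<close> is used.\<close>

definition word_pow :: "'b word \<Rightarrow> int \<Rightarrow> 'b word" where
  "word_pow w \<alpha> = w [^]\<^bsub>free_group UNIV\<^esub> \<alpha>"

text \<open>A tuple of reduced words is a family \<open>h\<close> over a finite index set \<open>I\<close>. In a product \<open>g h\<close> of
  reduced words, the initial segment \<open>p\<close> of \<open>h\<close> cancels iff \<open>g\<close> ends with the inverse of \<open>p\<close>;
  dually for terminal segments.\<close>

definition exponents :: "'i \<Rightarrow> 'i \<Rightarrow> int set" where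
  "exponents i j = (if j = i then {0, 1} else {-1, 0, 1})"

definition initial_cancel :: "'i set \<Rightarrow> ('i \<Rightarrow> 'b word) \<Rightarrow> 'i \<Rightarrow> nat" where
  "initial_cancel I h i = Max {length p |p. prefix p (h i) \<and>
     (\<exists>j\<in>I. \<exists>\<alpha>\<in>exponents i j. suffix (inv_word p) (word_pow (h j) \<alpha>))}"

definition terminal_cancel :: "'i set \<Rightarrow> ('i \<Rightarrow> 'b word) \<Rightarrow> 'i \<Rightarrow> nat" where
  "terminal_cancel I h i = Max {length q |q. suffix q (h i) \<and>
     (\<exists>k\<in>I. \<exists>\<beta>\<in>exponents i k. prefix (inv_word q) (word_pow (h k) \<beta>))}"

definition tuple_has_remnant :: "'i set \<Rightarrow> ('i \<Rightarrow> 'b word) \<Rightarrow> bool" where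
  "tuple_has_remnant I h \<longleftrightarrow>
     (\<forall>i\<in>I. initial_cancel I h i + terminal_cancel I h i < length (h i))"

definition tuple_remnant :: "'i set \<Rightarrow> ('i \<Rightarrow> 'b word) \<Rightarrow> 'i \<Rightarrow> 'b word" where
  "tuple_remnant I h i =
     drop (initial_cancel I h i) (take (length (h i) - terminal_cancel I h i) (h i))"

text \<open>In the following, \<open>C\<close> is the free generating set of the domain of \<open>\<rho>\<close>.\<close>

definition has_remnant :: "'a set \<Rightarrow> ('a word \<Rightarrow> 'b word) \<Rightarrow> bool" where
  "has_remnant C \<rho> \<longleftrightarrow> tuple_has_remnant C (\<lambda>c. \<rho> (gen c))"

definition Rem :: "'a set \<Rightarrow> ('a word \<Rightarrow> 'b word) \<Rightarrow> 'a \<Rightarrow> 'b word" where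
  "Rem C \<rho> c = tuple_remnant C (\<lambda>c. \<rho> (gen c)) c"

end

theory Submission
  imports Defs
begin

text \<open>Suppose \<open>u = \<phi>(z) v \<psi>(z)\<^sup>-\<^sup>1\<close>. Then \<open>\<psi>(z) = u\<^sup>-\<^sup>1 \<phi>(z) v\<close> is the image under \<open>\<phi>bar\<close> of
  \<open>b\<^sub>1\<^sup>-\<^sup>1 z b\<^sub>2\<close>, which is a reduced word because \<open>z\<close> does not involve \<open>b\<^sub>1\<close> and \<open>b\<^sub>2\<close>. In the image of a
  reduced word the remnants of the images of all letters survive, so \<open>\<psi>(z)\<close> is longer than the sum
  of the lengths of the remnants of the letters of \<open>z\<close>; but that sum bounds \<open>|\<psi>(z)|\<close> from above.\<close>

section \<open>Inverse words and cancellation in a product of two reduced words\<close>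

lemma inv_word_inv_word [simp]: "inv_word (inv_word w) = w"
  by (simp add: inv_word_def rev_map comp_def)

lemma length_inv_word [simp]: "length (inv_word w) = length w"
  by (simp add: inv_word_def)

lemma inv_word_append: "inv_word (v @ w) = inv_word w @ inv_word v"
  by (simp add: inv_word_def)

lemma inv_word_Nil [simp]: "inv_word [] = []"
  by (simp add: inv_word_def)

lemma suffix_inv_word_iff: "suffix (inv_word p) w \<longleftrightarrow> prefix p (inv_word w)"
  by (metis inv_word_append inv_word_inv_word prefix_def suffix_def)

lemma reduced_append: "reduced (v @ w) \<Longrightarrow> reduced v \<and> reduced w"
  by (simp add: reduced_def successively_append_iff)

lemma reduced_ConsD: "reduced (l # w) \<Longrightarrow> reduced w"
  by (cases w) (simp_all add: reduced_def)

lemma length_reduce_le: "length (reduce w) \<le> length w"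
proof (induction w)
  case (Cons l w)
  have "length (push l v) \<le> Suc (length v)" for v :: "'a word"
    by (cases v) auto
  from this[of "reduce w"] show ?case
    using Cons by (simp add: reduce_def)
qed (simp add: reduce_def)

text \<open>Cancellation in a product of reduced words happens only at the junction: either the last
  letter of \<open>x\<close> meets its inverse at the head of \<open>y\<close> and both disappear,
  or nothing cancels at all. Induction from the right end of \<open>x\<close> follows this.\<close>

lemma reduce_append_cancel:
  assumes "reduced x" "reduced y"
  obtains a p b where "x = a @ inv_word p" "y = p @ b" "reduce (x @ y) = a @ b"
proof -
  have "\<exists>a p b. x = a @ inv_word p \<and> y = p @ b \<and> reduce (x @ y) = a @ b"
    using assms
  proof (induction x arbitrary: y rule: rev_induct)
    case Nil
    have "[] = [] @ inv_word []" "y = [] @ y" "reduce ([] @ y) = [] @ y"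
      using Nil by (simp_all add: reduce_reduced)
    then show ?case by blast
  next
    case (snoc l x)
    show ?case
    proof (cases "\<exists>y'. y = inv_letter l # y'")
      case True
      then obtain y' where y: "y = inv_letter l # y'" ..
      have "reduced x" "reduced y'"
        using snoc.prems reduced_append[of x "[l]"] by (auto simp: y reduced_ConsD)
      with snoc.IH obtain a p b where *: "x = a @ inv_word p" "y' = p @ b" "reduce (x @ y') = a @ b"
        by blast
      have "push l (push (inv_letter l) (reduce y')) = reduce y'"
        by (simp add: push_push_inv_letter)
      then have "reduce ((x @ [l]) @ y) = reduce (x @ y')"
        by (simp add: y reduce_def)
      with * have "x @ [l] = a @ inv_word (inv_letter l # p)" "y = (inv_letter l # p) @ b"
        "reduce ((x @ [l]) @ y) = a @ b"
        by (simp_all add: y inv_word_def)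
      then show ?thesis by blast
    next
      case False
      then have "reduced ((x @ [l]) @ y)"
        using snoc.prems unfolding reduced_def successively_append_iff[of _ "x @ [l]"]
        by (cases y) auto
      then have "x @ [l] = (x @ [l]) @ inv_word []" "y = [] @ y"
        "reduce ((x @ [l]) @ y) = (x @ [l]) @ y"
        by (simp_all add: reduce_reduced)
      then show ?thesis by blast
    qed
  qed
  then show thesis using that by blast
qed

section \<open>Images of letters and their cancellation bounds\<close>

lemma word_pow_1: "reduced w \<Longrightarrow> word_pow w 1 = w"
  unfolding word_pow_def
  by (subst group.int_pow_1[OF group_free_group]) (simp_all add: free_group_def)

lemma word_pow_minus_1: "reduced w \<Longrightarrow> word_pow w (- 1) = inv_word w"
proof -
  assume "reduced w"
  then have "w \<in> carrier (free_group UNIV)" by (simp add: free_group_def)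
  then show ?thesis
    by (simp add: word_pow_def group.int_pow_neg[OF group_free_group]
        group.int_pow_1[OF group_free_group] inv_free_group)
qed

definition letter_word :: "('i \<Rightarrow> 'b word) \<Rightarrow> 'i \<times> bool \<Rightarrow> 'b word" where
  "letter_word h l = (if snd l then h (fst l) else inv_word (h (fst l)))"

text \<open>The homomorphism of free groups sending generator \<open>i\<close> to
  \<open>h i\<close>, written as substitution followed by reduction so that list induction
  applies.\<close>

definition word_image :: "('i \<Rightarrow> 'b word) \<Rightarrow> 'i word \<Rightarrow> 'b word" where
  "word_image h w = reduce (concat (map (letter_word h) w))"

text \<open>An inverse letter maps to the inverse of \<open>h i\<close>, whose initial segments are
  the inverted terminal segments of \<open>h i\<close>; hence the two bounds swap.\<close>

definition left_cancel :: "'i set \<Rightarrow> ('i \<Rightarrow> 'b word) \<Rightarrow> 'i \<times> bool \<Rightarrow> nat" where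
  "left_cancel I h l = (if snd l then initial_cancel I h (fst l) else terminal_cancel I h (fst l))"

definition right_cancel :: "'i set \<Rightarrow> ('i \<Rightarrow> 'b word) \<Rightarrow> 'i \<times> bool \<Rightarrow> nat" where
  "right_cancel I h l = left_cancel I h (inv_letter l)"

lemma letter_word_inv_letter: "letter_word h (inv_letter l) = inv_word (letter_word h l)"
  by (simp add: letter_word_def inv_letter_def)

lemma length_le_initial_cancel:
  assumes "prefix p (h i)" "j \<in> I" "\<alpha> \<in> exponents i j" "suffix (inv_word p) (word_pow (h j) \<alpha>)"
  shows "length p \<le> initial_cancel I h i"
  unfolding initial_cancel_def
proof (rule Max_ge)
  \<comment> \<open>\<open>Max\<close> is a bound only on finite sets; here the lengths are at most
    \<open>length (h i)\<close>.\<close>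
  show "finite {length p |p. prefix p (h i) \<and>
     (\<exists>j\<in>I. \<exists>\<alpha>\<in>exponents i j. suffix (inv_word p) (word_pow (h j) \<alpha>))}"
    by (rule finite_subset[of _ "{..length (h i)}"]) (auto dest: prefix_length_le)
qed (use assms in blast)

lemma length_le_terminal_cancel:
  assumes "suffix q (h i)" "j \<in> I" "\<alpha> \<in> exponents i j" "prefix (inv_word q) (word_pow (h j) \<alpha>)"
  shows "length q \<le> terminal_cancel I h i"
  unfolding terminal_cancel_def
proof (rule Max_ge)
  show "finite {length q |q. suffix q (h i) \<and>
     (\<exists>j\<in>I. \<exists>\<alpha>\<in>exponents i j. prefix (inv_word q) (word_pow (h j) \<alpha>))}"
    by (rule finite_subset[of _ "{..length (h i)}"]) (auto dest: suffix_length_le)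
qed (use assms in blast)

lemma letter_word_eq_word_pow:
  assumes "reduced (h (fst l))"
  shows "letter_word h l = word_pow (h (fst l)) (if snd l then 1 else - 1)"
  using assms by (simp add: letter_word_def word_pow_1 word_pow_minus_1)

text \<open>The condition \<open>k \<noteq> inv_letter l\<close> matches the exponents allowed in
  the remnant: if both letters come from the same generator, they have the same sign, so the
  excluded exponent -1 does not arise.\<close>

lemma length_le_left_cancel:
  assumes h: "\<forall>i\<in>I. reduced (h i)" and l: "fst l \<in> I" and kl: "k \<noteq> inv_letter l"
    and p: "suffix (inv_word p) (letter_word h l)" "prefix p (letter_word h k)"
  shows "length p \<le> left_cancel I h k"
proof (cases "snd k")
  case True
  have "length p \<le> initial_cancel I h (fst k)"
  proof (rule length_le_initial_cancel)
    show "prefix p (h (fst k))" using True p by (simp add: letter_word_def)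
    show "fst l \<in> I" by (rule l)
    show "(if snd l then 1 else - 1) \<in> exponents (fst k) (fst l)"
      using True kl by (auto simp: exponents_def inv_letter_def prod_eq_iff)
    show "suffix (inv_word p) (word_pow (h (fst l)) (if snd l then 1 else - 1))"
      using p h l letter_word_eq_word_pow by metis
  qed
  then show ?thesis using True by (simp add: left_cancel_def)
next
  case False
  \<comment> \<open>For an inverse letter \<open>k\<close> the product is inverted: the junction of
    \<open>l\<close> and \<open>k\<close> becomes that of \<open>inv_letter k\<close> and
    \<open>inv_letter l\<close>, where a terminal segment of \<open>h (fst k)\<close>
    cancels.\<close>
  have "length (inv_word p) \<le> terminal_cancel I h (fst k)"
  proof (rule length_le_terminal_cancel)
    show "suffix (inv_word p) (h (fst k))"
      using False p by (simp add: letter_word_def suffix_inv_word_iff)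
    show "fst l \<in> I" by (rule l)
    show "(if snd (inv_letter l) then 1 else - 1) \<in> exponents (fst k) (fst l)"
      using False kl by (auto simp: exponents_def inv_letter_def prod_eq_iff)
    have "prefix p (letter_word h (inv_letter l))"
      using p by (simp add: letter_word_inv_letter suffix_inv_word_iff)
    then show "prefix (inv_word (inv_word p))
        (word_pow (h (fst l)) (if snd (inv_letter l) then 1 else - 1))"
      using h l letter_word_eq_word_pow[of h "inv_letter l"] by simp
  qed
  then show ?thesis using False by (simp add: left_cancel_def)
qed

text \<open>The mirror image, by inverting the product: \<open>inv_letter k\<close> takes the place
  of \<open>l\<close>, \<open>inv_letter l\<close> that of \<open>k\<close>, and \<open>p\<close>
  stays the same.\<close>

lemma length_le_right_cancel:
  assumes "\<forall>i\<in>I. reduced (h i)" "fst k \<in> I" "k \<noteq> inv_letter l"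
    and "suffix (inv_word p) (letter_word h l)" "prefix p (letter_word h k)"
  shows "length p \<le> right_cancel I h l"
  unfolding right_cancel_def
proof (rule length_le_left_cancel[of I h "inv_letter k"])
  show "inv_letter l \<noteq> inv_letter (inv_letter k)" using assms(3) by auto
qed (use assms in \<open>simp_all add: letter_word_inv_letter suffix_inv_word_iff\<close>)

section \<open>Survival of remnants in the image of a reduced word\<close>

lemma length_tuple_remnant:
  "length (tuple_remnant I h i) = length (h i) - terminal_cancel I h i - initial_cancel I h i"
  by (simp add: tuple_remnant_def)

text \<open>Having remnant makes the truncated subtractions exact, for letters of either
  sign.\<close>

lemma length_letter_word:
  assumes "tuple_has_remnant I h" "fst l \<in> I"
  shows "length (letter_word h l)
    = left_cancel I h l + length (tuple_remnant I h (fst l)) + right_cancel I h l"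
    and "length (tuple_remnant I h (fst l)) > 0"
  using assms
  by (auto simp: tuple_has_remnant_def letter_word_def left_cancel_def right_cancel_def
      length_tuple_remnant inv_letter_def)

lemma reduced_letter_word:
  assumes "\<forall>i\<in>I. reduced (h i)" "fst l \<in> I"
  shows "reduced (letter_word h l)"
  using assms by (simp add: letter_word_def reduced_inv_word)

lemma word_image_Cons: "word_image h (l # w) = reduce (letter_word h l @ word_image h w)"
  by (simp add: word_image_def reduce_append reduce_reduced)

text \<open>The image of the first letter survives up to its right cancellation bound; this is what keeps
  a further letter on the left from cancelling beyond the first image.\<close>

lemma word_image_remnants:
  assumes h: "\<forall>i\<in>I. reduced (h i)" and rem: "tuple_has_remnant I h"
    and "reduced (l # w)" "fst ` set (l # w) \<subseteq> I"
  shows "\<exists>y. word_image h (l # w)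
      = take (length (letter_word h l) - right_cancel I h l) (letter_word h l) @ y
    \<and> (\<Sum>k\<leftarrow>w. length (tuple_remnant I h (fst k))) \<le> length y"
  using assms(3,4)
proof (induction w arbitrary: l)
  case Nil
  then have "word_image h [l] = letter_word h l"
    by (simp add: word_image_def reduce_reduced reduced_letter_word[OF h])
  then show ?case
    by (intro exI[of _ "drop (length (letter_word h l) - right_cancel I h l) (letter_word h l)"]) simp
next
  case (Cons k w)
  let ?W = "letter_word h" and ?L = "left_cancel I h" and ?R = "right_cancel I h"
  let ?rem = "\<lambda>k. length (tuple_remnant I h (fst k))"
  let ?t = "take (length (?W k) - ?R k) (?W k)"
  have I: "fst l \<in> I" "fst k \<in> I" and kl: "k \<noteq> inv_letter l"
    using Cons.prems by (auto simp: reduced_def)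
  obtain y where y: "word_image h (k # w) = ?t @ y" "(\<Sum>k\<leftarrow>w. ?rem k) \<le> length y"
    using Cons.IH[of k] Cons.prems reduced_ConsD[of l] by auto
  obtain a p b where apb: "?W l = a @ inv_word p" "?t @ y = p @ b" "reduce (?W l @ ?t @ y) = a @ b"
    by (metis reduce_append_cancel[of "?W l" "?t @ y"] reduced_letter_word[OF h I(1)] y(1)
        reduced_reduce word_image_def)
  \<comment> \<open>Inside \<open>?t\<close> the cancellation is between the images of
    \<open>l\<close> and \<open>k\<close> alone, so both bounds apply; beyond \<open>?t\<close>
    nothing is known about \<open>y\<close>.\<close>
  have bound: "length q \<le> ?L k \<and> length q \<le> ?R l" if "prefix q p" "prefix q ?t" for q
  proof -
    have "suffix (inv_word q) (?W l)"
      using that(1) apb(1) by (auto simp: inv_word_append suffix_def prefix_def)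
    moreover have "prefix q (?W k)"
      using that(2) take_is_prefix prefix_order.trans by blast
    ultimately show ?thesis
      using length_le_left_cancel length_le_right_cancel h I kl by metis
  qed
  have t: "length ?t = ?L k + ?rem k" and "?rem k > 0"
    using length_letter_word[OF rem I(2)] by simp_all
  \<comment> \<open>Cancellation cannot pass \<open>?t\<close>: otherwise all of \<open>?t\<close>
    would cancel, but it exceeds the bound \<open>?L k\<close> by the nonempty remnant of
    \<open>k\<close>.\<close>
  have "prefix p ?t"
  proof (rule ccontr)
    assume "\<not> prefix p ?t"
    then have "prefix ?t p"
      using apb(2) by (metis prefixI prefix_same_cases)
    with bound[of ?t] t \<open>?rem k > 0\<close> show False by simp
  qed
  then have p: "length p \<le> ?L k" "length p \<le> ?R l"
    using bound by simp_all
  \<comment> \<open>At most \<open>?R l\<close> letters of \<open>?W l\<close> are lost, so the part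
    to be kept lies within \<open>a\<close>.\<close>
  have "length (?W l) - ?R l \<le> length a"
    using apb(1) p(2) by simp
  then have "word_image h (l # k # w)
      = take (length (?W l) - ?R l) (?W l) @ drop (length (?W l) - ?R l) a @ b"
    using apb by (simp add: word_image_Cons[of h l] y(1))
  \<comment> \<open>Since \<open>p\<close> uses up at most \<open>?L k\<close> letters of
    \<open>?t\<close>, \<open>b\<close> still has room for the remnant of \<open>k\<close> and all
    of \<open>y\<close>.\<close>
  moreover have "length ?t + length y = length p + length b"
    using arg_cong[OF apb(2), of length] by (simp only: length_append)
  with t p(1) y(2) have "(\<Sum>k\<leftarrow>k # w. ?rem k) \<le> length (drop (length (?W l) - ?R l) a @ b)"
    by simp
  ultimately show ?case by blast
qed

text \<open>The segment kept from the first letter includes its remnant, which supplies the summand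
  absent from \<open>word_image_remnants\<close>.\<close>

corollary length_word_image_ge:
  assumes "\<forall>i\<in>I. reduced (h i)" "tuple_has_remnant I h" "reduced w" "fst ` set w \<subseteq> I"
  shows "(\<Sum>k\<leftarrow>w. length (tuple_remnant I h (fst k))) \<le> length (word_image h w)"
proof (cases w)
  case (Cons l w')
  then obtain y where "word_image h w
      = take (length (letter_word h l) - right_cancel I h l) (letter_word h l) @ y"
    "(\<Sum>k\<leftarrow>w'. length (tuple_remnant I h (fst k))) \<le> length y"
    using word_image_remnants assms by metis
  moreover have "fst l \<in> I" using assms(4) Cons by simp
  ultimately show ?thesis
    using length_letter_word[OF assms(2), of l] Cons by simp
qed simp

lemma length_word_image_le: "length (word_image h w) \<le> (\<Sum>k\<leftarrow>w. length (h (fst k)))"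
proof -
  have "length (concat (map (letter_word h) w)) = (\<Sum>k\<leftarrow>w. length (h (fst k)))"
    by (induction w) (simp_all add: letter_word_def)
  then show ?thesis
    unfolding word_image_def using length_reduce_le by metis
qed

section \<open>Homomorphisms of free groups as word images\<close>

lemma gen_closed: "i \<in> A \<Longrightarrow> gen i \<in> carrier (free_group A)"
  by (simp add: gen_def free_group_def reduced_def)

lemma hom_eq_word_image:
  assumes f: "f \<in> hom (free_group A) (free_group B)" and "w \<in> carrier (free_group A)"
  shows "f w = word_image (\<lambda>i. f (gen i)) w"
  using assms(2)
proof (induction w)
  interpret group_hom "free_group A" "free_group B" f
    using f by (simp add: group_hom_def group_hom_axioms_def group_free_group)
  {
    case Nil
    show ?case using hom_one by (simp add: free_group_def word_image_def reduce_def)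
  next
    case (Cons l w)
    then have c: "w \<in> carrier (free_group A)" "[l] \<in> carrier (free_group A)"
      and l: "gen (fst l) \<in> carrier (free_group A)"
      by (auto simp: free_group_def reduced_ConsD) (simp_all add: reduced_def gen_def)
    have "f [l] = letter_word (\<lambda>i. f (gen i)) l"
    proof (cases "snd l")
      case True
      then show ?thesis by (cases l) (simp add: letter_word_def gen_def)
    next
      case False
      have "[l] = inv\<^bsub>free_group A\<^esub> gen (fst l)"
        using False
        by (simp add: inv_free_group[OF l]) (simp add: gen_def inv_word_def inv_letter_def prod_eq_iff)
      then have "f [l] = inv_word (f (gen (fst l)))"
        using hom_inv[OF l] inv_free_group[OF hom_closed[OF l]] by simp
      then show ?thesis using False by (simp add: letter_word_def)
    qed
    \<comment> \<open>As \<open>l # w\<close> is reduced, prepending \<open>l\<close> is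
      multiplication in the group without cancellation.\<close>
    moreover have "[l] \<otimes>\<^bsub>free_group A\<^esub> w = l # w"
      using Cons.prems by (simp add: free_group_def reduce_reduced)
    then have "f (l # w) = f [l] \<otimes>\<^bsub>free_group B\<^esub> f w"
      using hom_mult[OF c(2) c(1)] by simp
    ultimately show ?case
      using Cons.IH[OF c(1)] by (simp add: word_image_Cons) (simp add: free_group_def)
  }
qed

theorem theorem3:
  fixes n :: nat and S :: "'b set"
    and \<phi> \<psi> \<phi>bar :: "nat word \<Rightarrow> 'b word" and u v :: "'b word"
  defines "G \<equiv> free_group {1..n}" and "H \<equiv> free_group S"
  assumes "finite S" and "card S > 1"
    and "\<phi> \<in> hom G H" and "\<psi> \<in> hom G H"
    and "u \<in> carrier H" and "v \<in> carrier H"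
    and "\<phi>bar \<in> hom (free_group {1..n + 2}) H"
    and "\<forall>w\<in>carrier G. \<phi>bar w = \<phi> w"
    and "\<phi>bar (gen (n + 1)) = u" and "\<phi>bar (gen (n + 2)) = v"
    and "has_remnant {1..n + 2} \<phi>bar"
    and "\<forall>i\<in>{1..n}. length (Rem {1..n + 2} \<phi>bar i) \<ge> length (\<psi> (gen i))"
  shows "\<not> doubly_twisted_conj G H \<phi> \<psi> u v"
proof
  define K where "K = free_group {1..n + 2}"
  define h where "h = (\<lambda>i. \<phi>bar (gen i))"
  note phi = assms(5) and psi = assms(6) and u = assms(7) and v = assms(8)
  interpret K: group K unfolding K_def by (rule group_free_group)
  interpret H: group H unfolding H_def by (rule group_free_group)
  interpret bar: group_hom K H \<phi>bar
    using assms(9) K.is_group H.is_group by (simp add: group_hom_def group_hom_axioms_def K_def)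
  assume "doubly_twisted_conj G H \<phi> \<psi> u v"
  then obtain z where z: "z \<in> carrier G" and uz: "u = \<phi> z \<otimes>\<^bsub>H\<^esub> v \<otimes>\<^bsub>H\<^esub> inv\<^bsub>H\<^esub> \<psi> z"
    unfolding doubly_twisted_conj_def by blast
  have z_set: "fst ` set z \<subseteq> {1..n}" and z_red: "reduced z"
    using z by (simp_all add: G_def free_group_def)
  have zK: "z \<in> carrier K"
    using z_set z_red by (auto simp: K_def free_group_def)
  have b: "gen (n + 1) \<in> carrier K" "gen (n + 2) \<in> carrier K"
    unfolding K_def by (simp_all add: gen_closed)
  have closed: "\<phi> z \<in> carrier H" "\<psi> z \<in> carrier H"
    using phi psi z by (simp_all add: hom_in_carrier)
  define x where "x = (n + 1, False) # z @ [(n + 2, True)]"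
  have x_red: "reduced x"
  proof -
    \<comment> \<open>The end letters of \<open>z\<close> have index at most \<open>n\<close>, so
      they cannot cancel with the added letters; for empty \<open>z\<close> the two added letters
      have different generators.\<close>
    have "fst (last z) \<in> {1..n}" "fst (hd z) \<in> {1..n}" if "z \<noteq> []"
      using z_set last_in_set[OF that] hd_in_set[OF that] by blast+
    then show ?thesis
      using z_red by (auto simp: x_def reduced_def successively_append_iff successively_Cons
          inv_letter_def hd_append prod_eq_iff)
  qed
  have x_set: "fst ` set x \<subseteq> {1..n + 2}"
    using z_set by (auto simp: x_def)
  have "inv\<^bsub>K\<^esub> gen (n + 1) = [(n + 1, False)]"
    using inv_free_group[OF b(1)[unfolded K_def]] K_def
    by (simp add: gen_def inv_word_def inv_letter_def)
  moreover have "z \<otimes>\<^bsub>K\<^esub> gen (n + 2) = z @ [(n + 2, True)]"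
    using reduced_ConsD[OF x_red[unfolded x_def]]
    by (simp add: K_def free_group_def gen_def reduce_reduced)
  ultimately have "inv\<^bsub>K\<^esub> gen (n + 1) \<otimes>\<^bsub>K\<^esub> (z \<otimes>\<^bsub>K\<^esub> gen (n + 2)) = x"
    using x_red by (simp add: K_def free_group_def x_def reduce_reduced)
  moreover have "\<phi>bar z = \<phi> z"
    using assms(10) z by blast
  ultimately have "\<phi>bar x = inv\<^bsub>H\<^esub> u \<otimes>\<^bsub>H\<^esub> (\<phi> z \<otimes>\<^bsub>H\<^esub> v)"
    using bar.hom_mult[OF K.inv_closed[OF b(1)] K.m_closed[OF zK b(2)]]
      bar.hom_mult[OF zK b(2)] bar.hom_inv[OF b(1)] assms(11,12)
    by simp
  \<comment> \<open>The assumed equation, multiplied on the right by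
    \<open>\<psi> z\<close>.\<close>
  also have "\<phi> z \<otimes>\<^bsub>H\<^esub> v = u \<otimes>\<^bsub>H\<^esub> \<psi> z"
    using H.inv_solve_right[OF u H.m_closed[OF closed(1) v] closed(2)] uz by simp
  also have "inv\<^bsub>H\<^esub> u \<otimes>\<^bsub>H\<^esub> (u \<otimes>\<^bsub>H\<^esub> \<psi> z) = \<psi> z"
    using u closed(2) H.m_assoc[symmetric] by simp
  finally have "\<phi>bar x = \<psi> z" .
  moreover have "\<phi>bar x = word_image h x"
    unfolding h_def
    by (rule hom_eq_word_image[OF assms(9)[unfolded H_def]])
      (use x_red x_set in \<open>simp add: free_group_def\<close>)
  moreover have "\<forall>i\<in>{1..n + 2}. reduced (h i)"
    using hom_in_carrier[OF assms(9) gen_closed] by (auto simp: h_def H_def free_group_def)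
  moreover have rem: "tuple_has_remnant {1..n + 2} h"
    using assms(13) by (simp add: has_remnant_def h_def)
  ultimately have "(\<Sum>k\<leftarrow>x. length (tuple_remnant {1..n + 2} h (fst k))) \<le> length (\<psi> z)"
    using length_word_image_ge[of "{1..n + 2}" h x] x_red x_set by simp
  \<comment> \<open>The nonempty remnant of \<open>u\<close> makes the inequality strict once the
    two added letters are dropped from the sum.\<close>
  moreover have "length (tuple_remnant {1..n + 2} h (n + 1)) > 0"
    using length_letter_word(2)[OF rem, of "(n + 1, True)"] by simp
  ultimately have "(\<Sum>k\<leftarrow>z. length (tuple_remnant {1..n + 2} h (fst k))) < length (\<psi> z)"
    by (simp add: x_def del: length_greater_0_conv)
  also have "length (\<psi> z) \<le> (\<Sum>k\<leftarrow>z. length (\<psi> (gen (fst k))))"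
    unfolding hom_eq_word_image[OF psi[unfolded G_def H_def] z[unfolded G_def]]
    by (rule length_word_image_le)
  \<comment> \<open>The hypothesis on \<open>|Rem|\<close> enters here, letter by letter; every
    letter of \<open>z\<close> has index in \<open>{1..n}\<close>.\<close>
  also have "\<dots> \<le> (\<Sum>k\<leftarrow>z. length (tuple_remnant {1..n + 2} h (fst k)))"
    by (rule sum_list_mono) (use assms(14) z_set in \<open>auto simp: Rem_def h_def\<close>)
  finally show False by simp
qed

end
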